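(* Let $E$ be a Banach space and $C\subseteq E$ an open cone whose closure $\overline C$ is a normal cone. Then the stochastic partial order $\{(\mu,\nu)\in\mathcal{P}(C)\times\mathcal{P}(C):\mu\le\nu\}$ is a closed subset of $\mathcal{P}(C)\times\mathcal{P}(C)$ endowed with the product of the weak topologies.
   Context: $E$ is a real Banach space and $C\subseteq E$ is a nonempty open (convex) cone whose closure $\overline C$ is a proper cone, i.e. $\overline C\cap(-\overline C)=\{0\}$. The closed partial order on $E$ is $x\le y$ iff $y-x\in\overline C$, and $C$ carries its restriction. $\overline C$ is normal if there is a constant $K$ such that $0\le x\le y$ implies $\|x\|\le K\|y\|$. $C$ carries the topology inherited from $E$ (it is also the topology of the complete Thompson metric on $C$). $\mathcal{P}(C)$ denotes the set of $\tau$-additive Borel probability measures on $C$ ($\mu(U)=\sup_\alpha\mu(U_\alpha)$ for every directed union $U=\bigcup_\alpha U_\alpha$ of open sets); since $C$ is completely metrizable, this is equivalent to inner regularity by compact sets and to the support having measure $1$. A subset $A\subseteq C$ is an upper set if $x\in A$, $y\in C$ and $x\le y$ imply $y\in A$. The stochastic order on $\mathcal{P}(C)$: $\mu\le\nu$ if $\mu(U)\le\nu(U)$ for each open upper set $U\subseteq C$. The weak topology on $\mathcal{P}(C)$: a net $\mu_\alpha\to\mu$ weakly iff $\int_C f\,d\mu_\alpha\to\int_C f\,d\mu$ for all bounded continuous $f:C\to\mathbb{R}$. *)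

theory Defs
  imports "HOL-Probability.Probability"
begin

(* The library notions "cone" and "conic" admit the scalar 0, and so force 0 into every nonempty
   cone; an open cone is only closed under multiplication by positive scalars. *)
definition open_cone :: "'a::real_normed_vector set \<Rightarrow> bool" where
  "open_cone C \<longleftrightarrow> C \<noteq> {} \<and> open C \<and> convex C \<and> (\<forall>x\<in>C. \<forall>c>0. c *\<^sub>R x \<in> C)"

definition proper_cone :: "'a::real_normed_vector set \<Rightarrow> bool" where
  "proper_cone K \<longleftrightarrow> K \<inter> uminus ` K = {0}"

(* The order induced on the whole space by a closed cone K. *)
definition cone_le :: "'a::real_normed_vector set \<Rightarrow> 'a \<Rightarrow> 'a \<Rightarrow> bool" where
  "cone_le K x y \<longleftrightarrow> y - x \<in> K"

definition normal_cone :: "'a::real_normed_vector set \<Rightarrow> bool" where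
  "normal_cone K \<longleftrightarrow>
     (\<exists>c::real. \<forall>x y. cone_le K 0 x \<and> cone_le K x y \<longrightarrow> norm x \<le> c * norm y)"

definition upper_set_of :: "'a::real_normed_vector set \<Rightarrow> 'a set \<Rightarrow> bool" where
  "upper_set_of C A \<longleftrightarrow>
     A \<subseteq> C \<and> (\<forall>x\<in>A. \<forall>y\<in>C. cone_le (closure C) x y \<longrightarrow> y \<in> A)"

definition directed_family :: "'a set set \<Rightarrow> bool" where
  "directed_family \<U> \<longleftrightarrow>
     \<U> \<noteq> {} \<and> (\<forall>U\<in>\<U>. \<forall>V\<in>\<U>. \<exists>W\<in>\<U>. U \<subseteq> W \<and> V \<subseteq> W)"

definition tau_additive :: "'a::topological_space set \<Rightarrow> 'a measure \<Rightarrow> bool" where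
  "tau_additive C M \<longleftrightarrow>
     (\<forall>\<U>. directed_family \<U> \<and> (\<forall>U\<in>\<U>. openin (top_of_set C) U) \<longrightarrow>
        emeasure M (\<Union>\<U>) = (SUP U\<in>\<U>. emeasure M U))"

(* The measures live on C itself: sets M = sets (restrict_space borel C) entails space M = C. *)
definition prob_measures :: "'a::topological_space set \<Rightarrow> 'a measure set" where
  "prob_measures C =
     {M. prob_space M \<and> sets M = sets (restrict_space borel C) \<and> tau_additive C M}"

definition stochastic_le ::
    "'a::real_normed_vector set \<Rightarrow> 'a measure \<Rightarrow> 'a measure \<Rightarrow> bool" where
  "stochastic_le C \<mu> \<nu> \<longleftrightarrow>
     (\<forall>U. openin (top_of_set C) U \<and> upper_set_of C U \<longrightarrow> emeasure \<mu> U \<le> emeasure \<nu> U)"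

(* Bounded continuous functions on C; values outside C are irrelevant. *)
definition bounded_continuous :: "'a::topological_space set \<Rightarrow> ('a \<Rightarrow> real) set" where
  "bounded_continuous C = {f. continuous_on C f \<and> bounded (f ` C)}"

(* The coarsest topology for which all integrals of bounded continuous functions are continuous;
   limitin_weak_topology below is the description by convergence. *)
definition weak_topology :: "'a::topological_space set \<Rightarrow> 'a measure topology" where
  "weak_topology C = topology_generated_by
     {{\<mu> \<in> prob_measures C. (\<integral>x. f x \<partial>\<mu>) \<in> S} | f S. f \<in> bounded_continuous C \<and> open S}"

lemma space_prob_measures:
  assumes "M \<in> prob_measures C"
  shows "space M = C"
proof -
  have "sets M = sets (restrict_space borel C)"
    using assms by (simp add: prob_measures_def)
  then have "space M = space (restrict_space borel C)"
    by (rule sets_eq_imp_space_eq)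
  then show ?thesis
    by (simp add: space_restrict_space)
qed

lemma integrable_bounded_continuous:
  fixes f :: "'a::topological_space \<Rightarrow> real"
  assumes "M \<in> prob_measures C" "f \<in> bounded_continuous C"
  shows "integrable M f"
proof -
  interpret prob_space M
    using assms(1) by (simp add: prob_measures_def)
  have "f \<in> borel_measurable (restrict_space borel C)"
    using assms(2) by (auto simp: bounded_continuous_def intro: borel_measurable_continuous_on_restrict)
  moreover have "sets M = sets (restrict_space borel C)"
    using assms(1) by (simp add: prob_measures_def)
  ultimately have meas: "f \<in> borel_measurable M"
    using measurable_cong_sets by blast
  obtain B where "\<And>x. x \<in> C \<Longrightarrow> norm (f x) \<le> B"
    using assms(2) by (auto simp: bounded_continuous_def bounded_iff)
  then show ?thesis
    using meas space_prob_measures[OF assms(1)] by (intro integrable_const_bound[of _ B]) auto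
qed

lemma topspace_weak_topology [simp]: "topspace (weak_topology C) = prob_measures C"
proof -
  have "(\<lambda>_. 0) \<in> bounded_continuous C"
    by (auto simp: bounded_continuous_def image_constant_conv)
  then have "prob_measures C \<in>
     {{\<mu> \<in> prob_measures C. (\<integral>x. f x \<partial>\<mu>) \<in> S} | f S. f \<in> bounded_continuous C \<and> open S}"
    by (intro CollectI exI[of _ "\<lambda>_. 0"] exI[of _ UNIV]) auto
  then show ?thesis
    unfolding weak_topology_def topology_generated_by_topspace by blast
qed

lemma limitin_weak_topology:
  "limitin (weak_topology C) X \<mu> F \<longleftrightarrow>
     \<mu> \<in> prob_measures C \<and> (\<forall>\<^sub>F i in F. X i \<in> prob_measures C) \<and>
     (\<forall>f\<in>bounded_continuous C. ((\<lambda>i. \<integral>x. f x \<partial>X i) \<longlongrightarrow> (\<integral>x. f x \<partial>\<mu>)) F)"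
  (is "?L \<longleftrightarrow> ?R")
proof
  assume L: ?L
  then have \<mu>: "\<mu> \<in> prob_measures C"
    using limitin_topspace by fastforce
  have ev: "\<forall>\<^sub>F i in F. X i \<in> prob_measures C"
    using L unfolding limitin_def by (metis openin_topspace topspace_weak_topology)
  have "((\<lambda>i. \<integral>x. f x \<partial>X i) \<longlongrightarrow> (\<integral>x. f x \<partial>\<mu>)) F" if f: "f \<in> bounded_continuous C" for f
  proof (rule topological_tendstoI)
    fix S :: "real set" assume S: "open S" "(\<integral>x. f x \<partial>\<mu>) \<in> S"
    let ?V = "{\<mu> \<in> prob_measures C. (\<integral>x. f x \<partial>\<mu>) \<in> S}"
    have "openin (weak_topology C) ?V"
      unfolding weak_topology_def using f S(1) by (intro topology_generated_by_Basis) blast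
    then have "\<forall>\<^sub>F i in F. X i \<in> ?V"
      using L \<mu> S(2) unfolding limitin_def by blast
    then show "\<forall>\<^sub>F i in F. (\<integral>x. f x \<partial>X i) \<in> S"
      by (rule eventually_mono) auto
  qed
  with \<mu> ev show ?R by blast
next
  assume R: ?R
  let ?G = "{{\<mu> \<in> prob_measures C. (\<integral>x. f x \<partial>\<mu>) \<in> S} | f S. f \<in> bounded_continuous C \<and> open S}"
  have "\<mu> \<in> U \<longrightarrow> (\<forall>\<^sub>F i in F. X i \<in> U)" if "generate_topology_on ?G U" for U
    using that
  proof induction
    case Empty
    then show ?case by simp
  next
    case (Int a b)
    then show ?case by (auto intro: eventually_conj)
  next
    case (UN K)
    show ?case
    proof
      assume "\<mu> \<in> \<Union>K"
      then obtain k where k: "k \<in> K" "\<mu> \<in> k" by blast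
      then have "\<forall>\<^sub>F i in F. X i \<in> k" using UN by blast
      then show "\<forall>\<^sub>F i in F. X i \<in> \<Union>K"
        by (rule eventually_mono) (use k in blast)
    qed
  next
    case (Basis s)
    then obtain f S where s: "s = {\<mu> \<in> prob_measures C. (\<integral>x. f x \<partial>\<mu>) \<in> S}"
      and f: "f \<in> bounded_continuous C" "open S" by blast
    show ?case
    proof
      assume "\<mu> \<in> s"
      then have "\<forall>\<^sub>F i in F. (\<integral>x. f x \<partial>X i) \<in> S"
        using R f s by (auto dest!: bspec intro: topological_tendstoD)
      then show "\<forall>\<^sub>F i in F. X i \<in> s"
        using R s by (auto intro: eventually_conj)
    qed
  qed
  then have "\<mu> \<in> U \<longrightarrow> (\<forall>\<^sub>F i in F. X i \<in> U)" if "openin (weak_topology C) U" for U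
    using that unfolding weak_topology_def openin_topology_generated_by_iff by blast
  then show ?L
    using R unfolding limitin_def by simp
qed

end

theory Submission
  imports Defs
begin

text \<open>
  The stochastic order is determined by the inequalities between the integrals of increasing
  nonnegative bounded continuous functions, and each such inequality defines a closed set of pairs.
  For a nonempty open upper set \<open>U\<close>, let \<open>p x\<close> be the infimum of all \<open>r > 0\<close> with \<open>r x \<in> U\<close>. This gauge
  is antitone and continuous, and \<open>U\<close> is exactly the set where \<open>p < 1\<close>, so the increasing continuous
  functions \<open>min 1 (n * max 0 (1 - p))\<close> converge pointwise to the indicator of \<open>U\<close>. Hence the integral
  inequalities imply the stochastic order; the converse is the layer cake formula, since
  superlevel sets of increasing continuous functions are open upper sets.
\<close>

section \<open>Scaling and absorption in an open cone\<close>

lemma open_cone_scaleR: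
  assumes "open_cone C" "x \<in> C" "0 < r"
  shows "r *\<^sub>R x \<in> C"
  using assms by (simp add: open_cone_def)

text \<open>Positive scaling commutes with closure, so \<open>closure C\<close> is stable under it
  as well.\<close>

lemma cone_le_scaleR:
  assumes "open_cone C" "cone_le (closure C) x y" "0 < r"
  shows "cone_le (closure C) (r *\<^sub>R x) (r *\<^sub>R y)"
proof -
  have "r *\<^sub>R (y - x) \<in> (*\<^sub>R) r ` closure C"
    using assms(2) unfolding cone_le_def by (rule imageI)
  also have "(*\<^sub>R) r ` closure C = closure ((*\<^sub>R) r ` C)"
    by (rule closure_scaleR)
  also have "\<dots> \<subseteq> closure C"
    using assms(1,3) by (intro closure_mono) (auto simp: open_cone_scaleR)
  finally show ?thesis
    by (simp add: cone_le_def scaleR_diff_right)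
qed

lemma cone_le_scaleR_self:
  assumes "open_cone C" "x \<in> C" "r < s"
  shows "cone_le (closure C) (r *\<^sub>R x) (s *\<^sub>R x)"
proof -
  have "(s - r) *\<^sub>R x \<in> C"
    using assms by (simp add: open_cone_scaleR)
  then show ?thesis
    by (simp add: cone_le_def scaleR_left_diff_distrib[symmetric] closure_def)
qed

lemma upper_set_ofD:
  assumes "upper_set_of C U" "x \<in> U" "y \<in> C" "cone_le (closure C) x y"
  shows "y \<in> U"
  using assms by (auto simp: upper_set_of_def)

text \<open>Since \<open>C\<close> is open, \<open>x - e *\<^sub>R u\<close> stays in
  \<open>C\<close> for small \<open>e > 0\<close>; dividing by \<open>e\<close> gives the factor
  \<open>r = 1 / e\<close>.\<close>

lemma open_cone_absorbs:
  assumes "open_cone C" "x \<in> C"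
  obtains r where "0 < r" "r *\<^sub>R x - u \<in> C"
proof -
  have "((\<lambda>e. x - e *\<^sub>R u) \<longlongrightarrow> x - 0 *\<^sub>R u) (at_right 0)"
    by (intro tendsto_intros)
  then have "\<forall>\<^sub>F e in at_right 0. x - e *\<^sub>R u \<in> C"
    using assms by (auto simp: open_cone_def intro: topological_tendstoD)
  moreover have "\<forall>\<^sub>F e::real in at_right 0. 0 < e"
    by (rule eventually_at_right_less)
  ultimately have "\<forall>\<^sub>F e in at_right 0. 0 < e \<and> x - e *\<^sub>R u \<in> C"
    by eventually_elim simp
  then obtain e :: real where e: "0 < e" "x - e *\<^sub>R u \<in> C"
    using eventually_happens[of _ "at_right (0::real)"] by force
  then have "(1 / e) *\<^sub>R (x - e *\<^sub>R u) \<in> C"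
    using assms(1) by (intro open_cone_scaleR) auto
  then show ?thesis
    using e(1) by (intro that[of "1 / e"]) (auto simp: scaleR_diff_right)
qed

section \<open>The gauge of an open upper set\<close>

text \<open>A Minkowski-type functional, meant for points of \<open>C\<close>: for a nonempty upper
  set \<open>U\<close>, absorption makes the set of factors nonempty there, so the real
  \<open>Inf\<close> is a true infimum. It may be \<open>0\<close>, as for
  \<open>U = C\<close>.\<close>

definition upper_gauge :: "'a::real_normed_vector set \<Rightarrow> 'a \<Rightarrow> real" where
  "upper_gauge U x = Inf {r. 0 < r \<and> r *\<^sub>R x \<in> U}"

context
  fixes C U :: "'a::real_normed_vector set"
  assumes C: "open_cone C"
    and U: "openin (top_of_set C) U" "upper_set_of C U" "U \<noteq> {}"
begin

private lemma openU: "open U"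
  using C U(1) by (metis open_cone_def openin_open_eq)

private lemma subU: "U \<subseteq> C"
  using U(2) by (simp add: upper_set_of_def)

lemma upper_gauge_set_nonempty:
  assumes "x \<in> C"
  shows "{r. 0 < r \<and> r *\<^sub>R x \<in> U} \<noteq> {}"
proof -
  obtain u where u: "u \<in> U"
    using U(3) by blast
  obtain r where r: "0 < r" "r *\<^sub>R x - u \<in> C"
    using open_cone_absorbs[OF C assms] by blast
  have "r *\<^sub>R x \<in> U"
    using r C assms closure_subset
    by (intro upper_set_ofD[OF U(2) u]) (auto simp: cone_le_def open_cone_scaleR)
  with r show ?thesis by blast
qed

lemma upper_gauge_nonneg:
  assumes "x \<in> C"
  shows "0 \<le> upper_gauge U x"
  unfolding upper_gauge_def
  using upper_gauge_set_nonempty[OF assms] by (intro cInf_greatest) auto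

text \<open>The admissible factors form an up-set, because multiples of \<open>x\<close> increase
  with the factor, and an open one, because \<open>U\<close> is open. Hence the infimum is not
  itself admissible and the inequality is strict.\<close>

lemma upper_gauge_less_iff:
  assumes x: "x \<in> C" and r: "0 < r"
  shows "upper_gauge U x < r \<longleftrightarrow> r *\<^sub>R x \<in> U"
proof -
  have "bdd_below {r. 0 < r \<and> r *\<^sub>R x \<in> U}"
    by (intro bdd_belowI[of _ 0]) auto
  then have "upper_gauge U x < r \<longleftrightarrow> (\<exists>s. 0 < s \<and> s *\<^sub>R x \<in> U \<and> s < r)"
    unfolding upper_gauge_def using upper_gauge_set_nonempty[OF x]
    by (subst cInf_less_iff) auto
  also have "\<dots> \<longleftrightarrow> r *\<^sub>R x \<in> U"
  proof
    assume "\<exists>s. 0 < s \<and> s *\<^sub>R x \<in> U \<and> s < r"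
    then show "r *\<^sub>R x \<in> U"
      using upper_set_ofD[OF U(2)] cone_le_scaleR_self[OF C x] open_cone_scaleR[OF C x r] by blast
  next
    assume "r *\<^sub>R x \<in> U"
    moreover have "((\<lambda>s. s *\<^sub>R x) \<longlongrightarrow> r *\<^sub>R x) (at_left r)"
      by (intro tendsto_intros)
    ultimately have "\<forall>\<^sub>F s in at_left r. s *\<^sub>R x \<in> U"
      using openU by (auto intro: topological_tendstoD)
    moreover have "\<forall>\<^sub>F s in at_left r. s \<in> {0<..<r}"
      using r by (rule eventually_at_left_real)
    ultimately have "\<forall>\<^sub>F s in at_left r. 0 < s \<and> s *\<^sub>R x \<in> U \<and> s < r"
      by eventually_elim simp
    then show "\<exists>s. 0 < s \<and> s *\<^sub>R x \<in> U \<and> s < r"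
      using eventually_happens[of _ "at_left r"] by force
  qed
  finally show ?thesis .
qed

text \<open>Positive scaling preserves the order, so every factor that moves \<open>x\<close> into
  \<open>U\<close> moves \<open>y\<close> into \<open>U\<close>.\<close>

lemma upper_gauge_antimono:
  assumes "x \<in> C" "y \<in> C" "cone_le (closure C) x y"
  shows "upper_gauge U y \<le> upper_gauge U x"
proof (rule dense_ge)
  fix r assume r: "upper_gauge U x < r"
  with upper_gauge_nonneg[OF assms(1)] have "0 < r" by linarith
  with r assms show "upper_gauge U y \<le> r"
    using upper_set_ofD[OF U(2) _ _ cone_le_scaleR[OF C assms(3)]] open_cone_scaleR[OF C]
      upper_gauge_less_iff less_imp_le by metis
qed

text \<open>Upper semicontinuity comes from the openness of \<open>U\<close>, lower semicontinuity
  from the openness of \<open>C\<close>.\<close>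

lemma continuous_on_upper_gauge: "continuous_on C (upper_gauge U)"
  unfolding continuous_on_def
proof (intro ballI order_tendstoI)
  fix x a assume x: "x \<in> C" and a: "upper_gauge U x < a"
  then have a0: "0 < a"
    using upper_gauge_nonneg[OF x] by linarith
  have "((\<lambda>y. a *\<^sub>R y) \<longlongrightarrow> a *\<^sub>R x) (at x within C)"
    by (intro tendsto_intros)
  then have "\<forall>\<^sub>F y in at x within C. a *\<^sub>R y \<in> U"
    using openU upper_gauge_less_iff[OF x a0] a by (auto intro: topological_tendstoD)
  moreover have "\<forall>\<^sub>F y in at x within C. y \<in> C"
    by (auto simp: eventually_at_filter)
  ultimately show "\<forall>\<^sub>F y in at x within C. upper_gauge U y < a"
    by eventually_elim (simp add: upper_gauge_less_iff a0)
next
  fix x a assume x: "x \<in> C" and a: "a < upper_gauge U x"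
  have inC: "\<forall>\<^sub>F y in at x within C. y \<in> C"
    by (auto simp: eventually_at_filter)
  show "\<forall>\<^sub>F y in at x within C. a < upper_gauge U y"
  \<comment> \<open>A negative \<open>a\<close> lies below all values on \<open>C\<close>; otherwise
    the levels chosen above \<open>a\<close> are positive and can serve as scaling factors.\<close>
  proof (cases "a < 0")
    case True
    show ?thesis
      using inC by eventually_elim (use True upper_gauge_nonneg in force)
  next
    case False
    \<comment> \<open>The level \<open>s\<close> keeps \<open>s *\<^sub>R x\<close> outside
      \<open>U\<close>; the gap \<open>r < s\<close> puts \<open>(s - r) *\<^sub>R x\<close> into
      the open set \<open>C\<close>, which leaves room to replace \<open>x\<close> by a nearby
      \<open>y\<close>.\<close>
    obtain s where s: "a < s" "s < upper_gauge U x"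
      using a dense by blast
    obtain r where r: "a < r" "r < s"
      using s(1) dense by blast
    have pos: "0 < r" "0 < s" "r \<noteq> 0"
      using False r by auto
    text \<open>Near \<open>x\<close> we have \<open>y \<le> (s / r) x\<close>, so the gauge of \<open>y\<close> is at least \<open>r / s\<close> times that of \<open>x\<close>.\<close>
    have "((\<lambda>y. s *\<^sub>R x - r *\<^sub>R y) \<longlongrightarrow> s *\<^sub>R x - r *\<^sub>R x) (at x within C)"
      by (intro tendsto_intros)
    moreover have "s *\<^sub>R x - r *\<^sub>R x \<in> C"
      using open_cone_scaleR[OF C x, of "s - r"] r by (simp add: scaleR_left_diff_distrib)
    ultimately have "\<forall>\<^sub>F y in at x within C. s *\<^sub>R x - r *\<^sub>R y \<in> C"
      using C by (auto simp: open_cone_def intro: topological_tendstoD)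
    with inC show ?thesis
    proof eventually_elim
      case (elim y)
      have "\<not> upper_gauge U y < r"
      proof
        assume "upper_gauge U y < r"
        then have "r *\<^sub>R y \<in> U"
          using elim(1) pos(1) by (simp add: upper_gauge_less_iff)
        then have "s *\<^sub>R x \<in> U"
          using elim(2) open_cone_scaleR[OF C x pos(2)] closure_subset
          by (intro upper_set_ofD[OF U(2) \<open>r *\<^sub>R y \<in> U\<close>]) (auto simp: cone_le_def)
        with s(2) pos(2) show False
          using upper_gauge_less_iff[OF x] by fastforce
      qed
      with r show ?case by linarith
    qed
  qed
qed

end

section \<open>Increasing functions approximating indicators\<close>

text \<open>Boundedness and continuity make the integral weakly continuous; nonnegativity suits the
  layer cake formula.\<close>

definition increasing_functions :: "'a::real_normed_vector set \<Rightarrow> ('a \<Rightarrow> real) set" where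
  "increasing_functions C = {f \<in> bounded_continuous C.
     (\<forall>x\<in>C. 0 \<le> f x) \<and> monotone_on C (cone_le (closure C)) (\<le>) f}"

lemma indicator_upper_set_limit:
  fixes C :: "'a::real_normed_vector set"
  assumes C: "open_cone C"
    and U: "openin (top_of_set C) U" "upper_set_of C U"
  obtains f :: "nat \<Rightarrow> 'a \<Rightarrow> real"
  where "\<And>n. f n \<in> increasing_functions C" "\<And>n x. f n x \<in> {0..1}"
    "\<And>x. x \<in> C \<Longrightarrow> (\<lambda>n. f n x) \<longlonglongrightarrow> indicator U x"
proof (cases "U = {}")
  case True
  then show ?thesis
    by (intro that[of "\<lambda>n x. 0"])
       (auto simp: increasing_functions_def bounded_continuous_def monotone_on_def image_constant_conv)
next
  case False
  \<comment> \<open>On \<open>C\<close> the ramp \<open>max 0 (1 - upper_gauge U x)\<close> is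
    positive exactly on \<open>U\<close>. Steepened by \<open>n\<close> and capped at 1, it is
    eventually 1 at each point of \<open>U\<close> and stays 0 off \<open>U\<close>.\<close>
  define f where "f = (\<lambda>(n::nat) x. min 1 (real n * max 0 (1 - upper_gauge U x)))"
  have range: "f n x \<in> {0..1}" for n x
    by (auto simp: f_def)
  have "f n \<in> increasing_functions C" for n
  proof -
    have "continuous_on C (f n)"
      unfolding f_def using continuous_on_upper_gauge[OF C U False]
      by (intro continuous_intros)
    moreover have "bounded (f n ` C)"
      by (rule bounded_subset[of "{0..1}"]) (use range in auto)
    moreover have "monotone_on C (cone_le (closure C)) (\<le>) (f n)"
      unfolding f_def using upper_gauge_antimono[OF C U False]
      by (intro monotone_onI min.mono mult_left_mono max.mono diff_left_mono) auto
    ultimately show ?thesis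
      using range by (auto simp: increasing_functions_def bounded_continuous_def)
  qed
  moreover have "(\<lambda>n. f n x) \<longlonglongrightarrow> indicator U x" if x: "x \<in> C" for x
  proof (cases "x \<in> U")
    case True
    then have p: "0 < 1 - upper_gauge U x"
      using upper_gauge_less_iff[OF C U False x, of 1] by simp
    obtain N where N: "1 < real N * (1 - upper_gauge U x)"
      using reals_Archimedean3[OF p] by blast
    have "f n x = 1" if "N \<le> n" for n
    proof -
      have "real N * (1 - upper_gauge U x) \<le> real n * (1 - upper_gauge U x)"
        using that p by (intro mult_right_mono) auto
      with N have "1 \<le> real n * (1 - upper_gauge U x)" by linarith
      with p show ?thesis by (simp add: f_def)
    qed
    then show ?thesis
      using True by (intro tendsto_eventually) (auto simp: eventually_sequentially)
  next
    case outside: False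
    then have "1 \<le> upper_gauge U x"
      using upper_gauge_less_iff[OF C U False x, of 1] by simp
    then show ?thesis
      using outside by (simp add: f_def)
  qed
  ultimately show ?thesis
    using that range by blast
qed

section \<open>Stochastic order and integrals\<close>

text \<open>The positive part of \<open>f x\<close> is the length of \<open>{0..<f x}\<close>, and
  Tonelli exchanges the two integrals. \<open>ennreal\<close> turns negative values into 0.\<close>

lemma (in sigma_finite_measure) nn_integral_layer_cake:
  fixes f :: "'a \<Rightarrow> real"
  assumes [measurable]: "f \<in> borel_measurable M"
  shows "(\<integral>\<^sup>+x. ennreal (f x) \<partial>M) =
    (\<integral>\<^sup>+t. indicator {0..} t * emeasure M {x \<in> space M. t < f x} \<partial>lborel)"
proof -
  interpret pair_sigma_finite M lborel
    by standard
  have "(\<integral>\<^sup>+x. ennreal (f x) \<partial>M) = (\<integral>\<^sup>+x. \<integral>\<^sup>+t. indicator {t. 0 \<le> t \<and> t < f x} t \<partial>lborel \<partial>M)"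
  proof (rule nn_integral_cong)
    fix x
    have "{t. 0 \<le> t \<and> t < f x} = {0..<f x}" by auto
    then show "ennreal (f x) = (\<integral>\<^sup>+t. indicator {t. 0 \<le> t \<and> t < f x} t \<partial>lborel)"
      by (cases "0 \<le> f x") (auto simp: ennreal_neg)
  qed
  also have "\<dots> = (\<integral>\<^sup>+t. \<integral>\<^sup>+x. indicator {t. 0 \<le> t \<and> t < f x} t \<partial>M \<partial>lborel)"
    by (rule Fubini'[symmetric]) measurable
  also have "\<dots> = (\<integral>\<^sup>+t. indicator {0..} t * emeasure M {x \<in> space M. t < f x} \<partial>lborel)"
  proof (rule nn_integral_cong)
    fix t
    have "(\<integral>\<^sup>+x. indicator {t. 0 \<le> t \<and> t < f x} t \<partial>M) =
        (\<integral>\<^sup>+x. indicator {0..} t * indicator {x \<in> space M. t < f x} x \<partial>M)"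
      by (intro nn_integral_cong) (auto split: split_indicator)
    then show "(\<integral>\<^sup>+x. indicator {t. 0 \<le> t \<and> t < f x} t \<partial>M) =
        indicator {0..} t * emeasure M {x \<in> space M. t < f x}"
      by (simp add: nn_integral_cmult_indicator)
  qed
  finally show ?thesis .
qed

lemma stochastic_le_imp_integral_le:
  assumes M: "\<mu> \<in> prob_measures C" "\<nu> \<in> prob_measures C"
    and le: "stochastic_le C \<mu> \<nu>" and f: "f \<in> increasing_functions C"
  shows "(\<integral>x. f x \<partial>\<mu>) \<le> (\<integral>x. f x \<partial>\<nu>)"
proof -
  have fb: "f \<in> bounded_continuous C" and f0: "\<And>x. x \<in> C \<Longrightarrow> 0 \<le> f x"
    and mono: "monotone_on C (cone_le (closure C)) (\<le>) f"
    using f by (auto simp: increasing_functions_def)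
  have lift: "(\<integral>\<^sup>+x. ennreal (f x) \<partial>N) = ennreal (\<integral>x. f x \<partial>N) \<and>
      (\<integral>\<^sup>+x. ennreal (f x) \<partial>N) = (\<integral>\<^sup>+t. indicator {0..} t * emeasure N {x \<in> C. t < f x} \<partial>lborel)"
    if N: "N \<in> prob_measures C" for N
  proof -
    interpret prob_space N
      using N by (simp add: prob_measures_def)
    have int: "integrable N f"
      by (rule integrable_bounded_continuous[OF N fb])
    have sp: "space N = C"
      by (rule space_prob_measures[OF N])
    have "(\<integral>\<^sup>+x. ennreal (f x) \<partial>N) = ennreal (\<integral>x. f x \<partial>N)"
      using f0 sp by (intro nn_integral_eq_integral[OF int] AE_I2) auto
    with nn_integral_layer_cake[of f] int show ?thesis
      by (simp add: sp)
  qed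
  have "emeasure \<mu> {x \<in> C. t < f x} \<le> emeasure \<nu> {x \<in> C. t < f x}" for t
  proof -
    have "openin (top_of_set C) (C \<inter> f -` {t<..})"
      using fb by (intro continuous_openin_preimage_gen) (auto simp: bounded_continuous_def)
    also have "C \<inter> f -` {t<..} = {x \<in> C. t < f x}"
      by auto
    finally have "openin (top_of_set C) {x \<in> C. t < f x}" .
    moreover have "upper_set_of C {x \<in> C. t < f x}"
      using mono by (force simp: upper_set_of_def monotone_on_def)
    ultimately show ?thesis
      using le by (simp add: stochastic_le_def)
  qed
  then have "ennreal (\<integral>x. f x \<partial>\<mu>) \<le> ennreal (\<integral>x. f x \<partial>\<nu>)"
    using lift[OF M(1)] lift[OF M(2)] by (metis (no_types, lifting) mult_left_mono nn_integral_mono zero_le)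
  \<comment> \<open>Sign information is required to drop \<open>ennreal\<close>, which would send a
    negative right-hand side to 0.\<close>
  moreover have "0 \<le> (\<integral>x. f x \<partial>\<nu>)"
    using f0 space_prob_measures[OF M(2)] by (intro Bochner_Integration.integral_nonneg_AE) auto
  ultimately show ?thesis
    by simp
qed

lemma integral_le_imp_stochastic_le:
  assumes C: "open_cone C" and M: "\<mu> \<in> prob_measures C" "\<nu> \<in> prob_measures C"
    and le: "\<And>f. f \<in> increasing_functions C \<Longrightarrow> (\<integral>x. f x \<partial>\<mu>) \<le> (\<integral>x. f x \<partial>\<nu>)"
  shows "stochastic_le C \<mu> \<nu>"
  unfolding stochastic_le_def
proof (intro allI impI, elim conjE)
  fix U assume U: "openin (top_of_set C) U" "upper_set_of C U"
  obtain f :: "nat \<Rightarrow> 'a \<Rightarrow> real"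
    where f: "\<And>n. f n \<in> increasing_functions C" "\<And>n x. f n x \<in> {0..1}"
      "\<And>x. x \<in> C \<Longrightarrow> (\<lambda>n. f n x) \<longlonglongrightarrow> indicator U x"
    using indicator_upper_set_limit[OF C U] by blast
  have lim: "(\<lambda>n. \<integral>x. f n x \<partial>N) \<longlonglongrightarrow> measure N U" if N: "N \<in> prob_measures C" for N
  proof -
    interpret prob_space N
      using N by (simp add: prob_measures_def)
    have sp: "space N = C"
      by (rule space_prob_measures[OF N])
    have "open U" "U \<subseteq> C"
      using C U by (auto simp: open_cone_def openin_open_eq upper_set_of_def)
    then have [measurable]: "U \<in> sets N"
      using N by (auto simp: prob_measures_def sets_restrict_space)
    have [measurable]: "f n \<in> borel_measurable N" for n
      using integrable_bounded_continuous[OF N] f(1) by (auto simp: increasing_functions_def)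
    \<comment> \<open>Dominated convergence: the values lie in \<open>{0..1}\<close>, and the
      constant 1 is integrable for a probability measure.\<close>
    have "(\<lambda>n. \<integral>x. f n x \<partial>N) \<longlonglongrightarrow> (\<integral>x. indicator U x \<partial>N)"
      using f(2,3) sp by (intro integral_dominated_convergence[where w = "\<lambda>_. 1"]) auto
    then show ?thesis
      using \<open>U \<subseteq> C\<close> sp by (simp add: Int_absorb2)
  qed
  have "measure \<mu> U \<le> measure \<nu> U"
    using lim[OF M(1)] lim[OF M(2)] by (rule LIMSEQ_le) (use le f(1) in blast)
  moreover have "finite_measure \<mu>" "finite_measure \<nu>"
    using M by (auto simp: prob_measures_def prob_space_def)
  ultimately show "emeasure \<mu> U \<le> emeasure \<nu> U"
    by (simp add: finite_measure.emeasure_eq_measure)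
qed

section \<open>Closedness in the product topology\<close>

text \<open>Preimages of open sets belong to the family generating the topology.\<close>

lemma continuous_map_weak_topology_integral:
  assumes "f \<in> bounded_continuous C"
  shows "continuous_map (weak_topology C) euclideanreal (\<lambda>\<mu>. \<integral>x. f x \<partial>\<mu>)"
proof -
  have "openin (weak_topology C) {\<mu> \<in> topspace (weak_topology C). (\<integral>x. f x \<partial>\<mu>) \<in> S}"
    if "open S" for S
    unfolding topspace_weak_topology unfolding weak_topology_def
    using assms that by (intro topology_generated_by_Basis) blast
  then show ?thesis
    by (simp only: continuous_map_def open_openin[symmetric] topspace_euclidean) simp
qed

theorem proposition5p5:
  fixes C :: "'a::banach set"
  assumes "open_cone C"
    and "proper_cone (closure C)"
    and "normal_cone (closure C)"
  shows "closedin (prod_topology (weak_topology C) (weak_topology C))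
           {(\<mu>, \<nu>) \<in> prob_measures C \<times> prob_measures C. stochastic_le C \<mu> \<nu>}"
proof -
  let ?W = "weak_topology C"
  let ?X = "prod_topology ?W ?W"
  \<comment> \<open>The difference form exhibits \<open>A f\<close> as the preimage of a closed
    half-line under one real function.\<close>
  define A where "A f = {z \<in> topspace ?X. (\<integral>x. f x \<partial>snd z) - (\<integral>x. f x \<partial>fst z) \<in> {0..}}"
    for f :: "'a \<Rightarrow> real"
  \<comment> \<open>A nonempty index set keeps the intersection inside
    \<open>topspace ?X\<close>.\<close>
  have "(\<lambda>_. 0) \<in> increasing_functions C"
    by (auto simp: increasing_functions_def bounded_continuous_def monotone_on_def image_constant_conv)
  then have ne: "increasing_functions C \<noteq> {}"
    by blast
  have "closedin ?X (A f)" if "f \<in> increasing_functions C" for f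
  proof -
    have "continuous_map ?W euclideanreal (\<lambda>\<mu>. \<integral>x. f x \<partial>\<mu>)"
      using that by (intro continuous_map_weak_topology_integral) (simp add: increasing_functions_def)
    then have "continuous_map ?X euclideanreal (\<lambda>z. (\<integral>x. f x \<partial>snd z) - (\<integral>x. f x \<partial>fst z))"
      using continuous_map_compose[OF continuous_map_fst]
        continuous_map_compose[OF continuous_map_snd]
      by (intro continuous_map_diff) (force simp: o_def)+
    then show ?thesis
      unfolding A_def by (rule closedin_continuous_map_preimage) simp
  qed
  then have "closedin ?X (\<Inter>f\<in>increasing_functions C. A f)"
    using ne by (intro closedin_INT)
  also have "(\<Inter>f\<in>increasing_functions C. A f) =
      {(\<mu>, \<nu>) \<in> prob_measures C \<times> prob_measures C. stochastic_le C \<mu> \<nu>}"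
    using ne stochastic_le_imp_integral_le integral_le_imp_stochastic_le[OF assms(1)]
    by (fastforce simp: A_def)
  finally show ?thesis .
qed

end
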